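(* Let $G$ be a finite group and let $H \subseteq K$ be subgroups of $G$. Then $$\Pr(H,\operatorname{Aut}(K)) \geq \frac{1}{|S(H,\operatorname{Aut}(K))|}\left(1+\frac{|S(H,\operatorname{Aut}(K))|-1}{|H:L(H,\operatorname{Aut}(K))|}\right).$$ Equality holds if and only if $\operatorname{orb}_K(x)=xS(H,\operatorname{Aut}(K))$ for all $x\in H\setminus L(H,\operatorname{Aut}(K))$.
   Context: For $x\in K$ and $\alpha\in\operatorname{Aut}(K)$ (the automorphism group of $K$), the autocommutator is $[x,\alpha]=x^{-1}\alpha(x)$. $\Pr(H,\operatorname{Aut}(K)) = \frac{|\{(x,\alpha)\in H\times \operatorname{Aut}(K) : [x,\alpha]=1\}|}{|H||\operatorname{Aut}(K)|}$. $S(H,\operatorname{Aut}(K))=\{[x,\alpha]:x\in H,\ \alpha\in\operatorname{Aut}(K)\}$ (a subset of $K$). $L(H,\operatorname{Aut}(K))=\{x\in H : [x,\alpha]=1 \text{ for all } \alpha\in\operatorname{Aut}(K)\}$, a subgroup of $H$. $\operatorname{orb}_K(x)=\{\alpha(x):\alpha\in\operatorname{Aut}(K)\}$, and $xS=\{xs:s\in S\}$. *)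

theory Defs
  imports Complex_Main "HOL-Algebra.Bij" "HOL-Algebra.Coset"
begin

text \<open>
  The argument \<open>K\<close> is a group and \<open>H\<close> a subset of its carrier; for a subgroup \<open>K\<close> of an ambient
  group \<open>G\<close>, take \<open>G\<lparr>carrier := K\<rparr>\<close>. The automorphisms in \<^const>\<open>auto\<close> are extensional on the
  carrier, so that \<open>card (auto K)\<close> really is the number of automorphisms of \<open>K\<close>.
\<close>

definition autocommutator :: "('a, 'b) monoid_scheme \<Rightarrow> 'a \<Rightarrow> ('a \<Rightarrow> 'a) \<Rightarrow> 'a"
  where "autocommutator K x \<alpha> = inv\<^bsub>K\<^esub> x \<otimes>\<^bsub>K\<^esub> \<alpha> x"

definition autocommuting_prob :: "('a, 'b) monoid_scheme \<Rightarrow> 'a set \<Rightarrow> real"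
  where "autocommuting_prob K H =
    real (card {(x, \<alpha>) \<in> H \<times> auto K. autocommutator K x \<alpha> = \<one>\<^bsub>K\<^esub>}) /
    (real (card H) * real (card (auto K)))"

definition autocommutator_set :: "('a, 'b) monoid_scheme \<Rightarrow> 'a set \<Rightarrow> 'a set"
  where "autocommutator_set K H = {autocommutator K x \<alpha> | x \<alpha>. x \<in> H \<and> \<alpha> \<in> auto K}"

definition autocentre :: "('a, 'b) monoid_scheme \<Rightarrow> 'a set \<Rightarrow> 'a set"
  where "autocentre K H = {x \<in> H. \<forall>\<alpha>\<in>auto K. autocommutator K x \<alpha> = \<one>\<^bsub>K\<^esub>}"

definition auto_orbit :: "('a, 'b) monoid_scheme \<Rightarrow> 'a \<Rightarrow> 'a set"
  where "auto_orbit K x = {\<alpha> x | \<alpha>. \<alpha> \<in> auto K}"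

definition subgroup_index :: "('a, 'b) monoid_scheme \<Rightarrow> 'a set \<Rightarrow> 'a set \<Rightarrow> nat"
  where "subgroup_index G H L = card (rcosets\<^bsub>G\<lparr>carrier := H\<rparr>\<^esub> L)"

end

theory Submission
  imports Defs "HOL-Algebra.Group_Action"
begin

text \<open>
  By the orbit-stabilizer theorem the probability is the average over \<open>x \<in> H\<close> of
  \<open>1 / |orb x|\<close>. Points of \<open>L\<close> have orbits of size \<open>1\<close>, and \<open>orb x \<subseteq> x S\<close> gives
  \<open>|orb x| \<le> |S|\<close> for the others. Equality holds iff all these inclusions are equalities.
\<close>

lemma auto_closed: "\<alpha> \<in> auto G \<Longrightarrow> x \<in> carrier G \<Longrightarrow> \<alpha> x \<in> carrier G"
  by (auto simp: auto_def hom_def)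

lemma auto_mult:
  "\<alpha> \<in> auto G \<Longrightarrow> x \<in> carrier G \<Longrightarrow> y \<in> carrier G \<Longrightarrow> \<alpha> (x \<otimes>\<^bsub>G\<^esub> y) = \<alpha> x \<otimes>\<^bsub>G\<^esub> \<alpha> y"
  by (auto simp: auto_def hom_def)

text \<open>Extensionality is what makes this work: an automorphism in \<open>auto G\<close> is
  determined by its values on the carrier, so \<open>auto G\<close> lies in a finite function
  space.\<close>

lemma finite_auto:
  assumes "finite (carrier G)"
  shows "finite (auto G)"
proof (rule finite_subset)
  show "auto G \<subseteq> carrier G \<rightarrow>\<^sub>E carrier G"
    by (auto simp: auto_def hom_def Bij_def PiE_def)
  show "finite (carrier G \<rightarrow>\<^sub>E carrier G)"
    using assms by (simp add: finite_PiE)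
qed

context group
begin

lemma auto_group_hom: "\<alpha> \<in> auto G \<Longrightarrow> group_hom G G \<alpha>"
  by (simp add: auto_def group_hom_def group_hom_axioms_def group_axioms)

text \<open>Automorphisms compose as they do in the group of bijections, so the inclusion is a
  homomorphism. This makes the orbit-stabilizer theorem available.\<close>

lemma group_action_auto: "group_action (AutoGroup G) (carrier G) (\<lambda>\<alpha>. \<alpha>)"
proof -
  have "(\<lambda>\<alpha>. \<alpha>) \<in> hom (AutoGroup G) (BijGroup (carrier G))"
    by (auto simp: hom_def AutoGroup_def BijGroup_def auto_def)
  then show ?thesis
    by (simp add: group_action_def group_hom_def group_hom_axioms_def AutoGroup group_BijGroup)
qed

lemma card_auto_orbit_stabilizer:
  assumes "x \<in> carrier G"
  shows "card (auto_orbit G x) * card {\<alpha> \<in> auto G. \<alpha> x = x} = card (auto G)"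
  using group_action.orbit_stabilizer_theorem [OF group_action_auto assms]
  by (simp add: orbit_def stabilizer_def auto_orbit_def order_def AutoGroup_def)

text \<open>Cancelling x on the left turns the commutator condition into a fixed-point condition, so
  stabilizers can be counted instead.\<close>

lemma autocommutator_eq_one_iff:
  assumes "x \<in> carrier G" "\<alpha> \<in> auto G"
  shows "autocommutator G x \<alpha> = \<one> \<longleftrightarrow> \<alpha> x = x"
  using assms auto_closed [OF assms(2,1)] inv_solve_left [of \<one> x "\<alpha> x"]
  by (auto simp: autocommutator_def)

lemma autocentre_eq:
  assumes "H \<subseteq> carrier G"
  shows "autocentre G H = {x \<in> H. \<forall>\<alpha>\<in>auto G. \<alpha> x = x}"
  using assms by (auto simp: autocentre_def autocommutator_eq_one_iff subset_iff)

text \<open>Fixed points of homomorphisms are closed under the group operations. Lagrange's theorem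
  needs this to express the index of L as a quotient of cardinalities.\<close>

lemma subgroup_autocentre:
  assumes "subgroup H G"
  shows "subgroup (autocentre G H) G"
proof -
  interpret H: subgroup H G by fact
  show ?thesis
    unfolding autocentre_eq [OF H.subset]
  proof (rule subgroupI)
    show "{x \<in> H. \<forall>\<alpha>\<in>auto G. \<alpha> x = x} \<noteq> {}"
      using group_hom.hom_one [OF auto_group_hom] H.one_closed by blast
  next
    fix a b
    assume "a \<in> {x \<in> H. \<forall>\<alpha>\<in>auto G. \<alpha> x = x}" "b \<in> {x \<in> H. \<forall>\<alpha>\<in>auto G. \<alpha> x = x}"
    then show "a \<otimes> b \<in> {x \<in> H. \<forall>\<alpha>\<in>auto G. \<alpha> x = x}"
      by (auto simp: auto_mult dest: bspec intro!: arg_cong2 [of _ _ _ _ "(\<otimes>)"])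
  qed (auto simp: group_hom.hom_inv [OF auto_group_hom])
qed

lemma subgroup_index_mult_card:
  assumes "subgroup H G" "subgroup L G" "L \<subseteq> H"
  shows "subgroup_index G H L * card L = card H"
  using group.lagrange [OF subgroup_imp_group [OF assms(1)] subgroup_incl [OF assms(2,1,3)]]
  by (simp add: subgroup_index_def order_def)

lemma finite_auto_orbit: "finite (carrier G) \<Longrightarrow> finite (auto_orbit G x)"
  by (simp add: auto_orbit_def finite_auto setcompr_eq_image)

lemma auto_orbit_self: "x \<in> carrier G \<Longrightarrow> x \<in> auto_orbit G x"
  \<comment> \<open>The witness is the identity restricted to the carrier, since members of
    \<open>auto G\<close> are extensional.\<close>
  unfolding auto_orbit_def using id_in_auto
  by (intro CollectI exI [of _ "\<lambda>x\<in>carrier G. x"]) simp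

lemma autocommutator_set_subset:
  assumes "H \<subseteq> carrier G"
  shows "autocommutator_set G H \<subseteq> carrier G"
  using assms by (auto simp: autocommutator_set_def autocommutator_def auto_closed subset_iff)

text \<open>Every orbit point factors as \<alpha>(x) = x (x^-1 \<alpha>(x)), whose second factor is
  an autocommutator.\<close>

lemma auto_orbit_subset:
  assumes "H \<subseteq> carrier G" "x \<in> H"
  shows "auto_orbit G x \<subseteq> x <# autocommutator_set G H"
proof
  fix y assume "y \<in> auto_orbit G x"
  then obtain \<alpha> where \<alpha>: "\<alpha> \<in> auto G" "y = \<alpha> x"
    by (auto simp: auto_orbit_def)
  then have "y = x \<otimes> autocommutator G x \<alpha>"
    using assms auto_closed [OF \<alpha>(1), of x]
    by (auto simp: autocommutator_def m_assoc [symmetric])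
  then show "y \<in> x <# autocommutator_set G H"
    using \<alpha> assms by (auto simp: l_coset_def autocommutator_set_def)
qed

text \<open>Left translation is injective on any subset; the set of autocommutators need not be a
  subgroup.\<close>

lemma card_l_coset:
  assumes "S \<subseteq> carrier G" "x \<in> carrier G"
  shows "card (x <# S) = card S"
proof -
  have "x <# S = (\<lambda>s. x \<otimes> s) ` S"
    by (auto simp: l_coset_def)
  moreover have "inj_on (\<lambda>s. x \<otimes> s) S"
    using assms by (auto simp: inj_on_def subset_iff)
  ultimately show ?thesis
    by (simp add: card_image)
qed

lemma autocommuting_prob_eq:
  assumes "finite (carrier G)" "H \<subseteq> carrier G"
  shows "autocommuting_prob G H = (\<Sum>x\<in>H. 1 / real (card (auto_orbit G x))) / real (card H)"
proof -
  have finH: "finite H"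
    using assms finite_subset by blast
  \<comment> \<open>Fibre the commuting pairs over their first component: the fibre at x is the
    stabilizer of x.\<close>
  have "{(x, \<alpha>) \<in> H \<times> auto G. autocommutator G x \<alpha> = \<one>}
      = (SIGMA x:H. {\<alpha> \<in> auto G. \<alpha> x = x})"
    using assms autocommutator_eq_one_iff by auto
  then have card_pairs: "card {(x, \<alpha>) \<in> H \<times> auto G. autocommutator G x \<alpha> = \<one>}
      = (\<Sum>x\<in>H. card {\<alpha> \<in> auto G. \<alpha> x = x})"
    using finH finite_auto [OF assms(1)] by simp
  have auto_pos: "card (auto G) > 0"
    using finite_auto [OF assms(1)] id_in_auto card_gt_0_iff by blast
  have "real (card {\<alpha> \<in> auto G. \<alpha> x = x}) / real (card (auto G))
      = 1 / real (card (auto_orbit G x))" if "x \<in> H" for x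
  proof -
    have *: "card (auto_orbit G x) * card {\<alpha> \<in> auto G. \<alpha> x = x} = card (auto G)"
      using that assms card_auto_orbit_stabilizer by blast
    \<comment> \<open>An orbit of size 0 would force \<open>auto G\<close> to have size 0.\<close>
    then have "card (auto_orbit G x) \<noteq> 0"
      using auto_pos by (metis mult_0 less_irrefl)
    with auto_pos show ?thesis
      by (simp add: field_simps flip: * of_nat_mult)
  qed
  then have "(\<Sum>x\<in>H. real (card {\<alpha> \<in> auto G. \<alpha> x = x})) / real (card (auto G))
      = (\<Sum>x\<in>H. 1 / real (card (auto_orbit G x)))"
    by (simp add: sum_divide_distrib)
  then show ?thesis
    unfolding autocommuting_prob_def card_pairs
    by (simp add: mult.commute [of "real (card H)"] flip: divide_divide_eq_left)
qed

text \<open>The inequality and its equality case both come from one exact identity: the probability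
  exceeds \<open>bound\<close> by a sum of nonnegative terms over H - L, divided by |H|.\<close>

proposition autocommuting_prob_bound:
  assumes fin: "finite (carrier G)" and H: "subgroup H G"
  defines "S \<equiv> autocommutator_set G H"
    and "L \<equiv> autocentre G H"
  defines "bound \<equiv> 1 / real (card S) * (1 + (real (card S) - 1) / real (subgroup_index G H L))"
  shows "autocommuting_prob G H \<ge> bound"
    and "autocommuting_prob G H = bound \<longleftrightarrow> (\<forall>x\<in>H - L. auto_orbit G x = x <# S)"
proof -
  let ?orb = "auto_orbit G"
  let ?diff = "\<lambda>x. 1 / real (card (?orb x)) - 1 / real (card S)"
  note HG = subgroup.subset [OF H]
  have finH: "finite H"
    using fin HG finite_subset by blast
  have LH: "L \<subseteq> H"
    by (auto simp: L_def autocentre_def)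
  have L: "subgroup L G"
    unfolding L_def by (rule subgroup_autocentre [OF H])
  have SG: "S \<subseteq> carrier G"
    unfolding S_def by (rule autocommutator_set_subset [OF HG])
  have finL: "finite L" and finS: "finite S"
    using LH finH SG fin finite_subset by blast+
  have cardL: "card L > 0" and cardH: "card H > 0"
    using L H finL finH subgroup.one_closed card_gt_0_iff by blast+
  have orb_pos: "card (?orb x) > 0" if "x \<in> H" for x
    using that HG auto_orbit_self finite_auto_orbit [OF fin] card_gt_0_iff by blast
  have card_coset: "card (x <# S) = card S" if "x \<in> H" for x
    using that HG SG card_l_coset by blast
  have sub: "?orb x \<subseteq> x <# S" if "x \<in> H" for x
    unfolding S_def using auto_orbit_subset [OF HG that] .
  have fin_coset: "finite (x <# S)" for x
    by (simp add: l_coset_def finS)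
  have orb_le: "card (?orb x) \<le> card S" if "x \<in> H" for x
    using card_mono [OF fin_coset sub [OF that]] card_coset [OF that] by simp
  \<comment> \<open>The orbit of the identity element of H is nonempty and has at most |S|
    elements.\<close>
  have cardS: "card S > 0"
    using orb_pos orb_le subgroup.one_closed [OF H] by (meson less_le_trans)
  have diff_nonneg: "?diff x \<ge> 0" if "x \<in> H" for x
    using orb_le [OF that] orb_pos [OF that] by (simp add: frac_le)
  have diff_zero_iff: "?diff x = 0 \<longleftrightarrow> ?orb x = x <# S" if "x \<in> H" for x
  proof -
    have "?diff x = 0 \<longleftrightarrow> card (?orb x) = card (x <# S)"
      using orb_pos [OF that] cardS by (simp add: card_coset [OF that])
    \<comment> \<open>A subset of a finite set with the same cardinality is the whole set.\<close>
    also have "\<dots> \<longleftrightarrow> ?orb x = x <# S"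
      using card_subset_eq [OF fin_coset sub [OF that]] by auto
    finally show ?thesis .
  qed
  have "?orb x = {x}" if "x \<in> L" for x
    using that auto_orbit_self [of x] HG unfolding L_def autocentre_eq [OF HG]
    by (auto simp: auto_orbit_def)
  then have sumL: "(\<Sum>x\<in>L. 1 / real (card (?orb x))) = real (card L)"
    by simp
  have "(\<Sum>x\<in>H. 1 / real (card (?orb x)))
      = (\<Sum>x\<in>H - L. 1 / real (card (?orb x))) + real (card L)"
    using sum.subset_diff [OF LH finH] sumL by metis
  \<comment> \<open>Split off the constant 1/|S| from each of the |H| - |L| terms; what is left is
    the excess \<open>?diff\<close>.\<close>
  also have "(\<Sum>x\<in>H - L. 1 / real (card (?orb x)))
      = sum ?diff (H - L) + (real (card H) - real (card L)) / real (card S)"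
    using card_Diff_subset [OF finL LH] card_mono [OF finH LH]
    by (simp add: sum_subtractf of_nat_diff)
  finally have prob: "autocommuting_prob G H
      = (sum ?diff (H - L) + (real (card H) - real (card L)) / real (card S) + real (card L))
        / real (card H)"
    by (simp add: autocommuting_prob_eq [OF fin HG])
  have "real (card H) = real (subgroup_index G H L) * real (card L)"
    using subgroup_index_mult_card [OF H L LH] by (metis of_nat_mult)
  then have index: "real (subgroup_index G H L) = real (card H) / real (card L)"
    using cardL by simp
  \<comment> \<open>With |H|/|L| for the index, |H| times \<open>bound\<close> equals (|H| -
    |L|)/|S| + |L|, which is \<open>prob\<close> without the excess.\<close>
  have prob_diff: "autocommuting_prob G H = bound + sum ?diff (H - L) / real (card H)"
    unfolding prob bound_def index using cardS cardL cardH by (simp add: field_simps)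
  have "sum ?diff (H - L) \<ge> 0"
    using diff_nonneg by (intro sum_nonneg) auto
  then show "autocommuting_prob G H \<ge> bound"
    by (simp add: prob_diff)
  have "autocommuting_prob G H = bound \<longleftrightarrow> sum ?diff (H - L) = 0"
    using cardH by (simp add: prob_diff)
  \<comment> \<open>A finite sum of nonnegative terms vanishes only if every term does.\<close>
  also have "\<dots> \<longleftrightarrow> (\<forall>x\<in>H - L. ?diff x = 0)"
    using finH diff_nonneg by (intro sum_nonneg_eq_0_iff) auto
  also have "\<dots> \<longleftrightarrow> (\<forall>x\<in>H - L. ?orb x = x <# S)"
    using diff_zero_iff by blast
  finally show "autocommuting_prob G H = bound \<longleftrightarrow> (\<forall>x\<in>H - L. ?orb x = x <# S)" .
qed

end

theorem theorem3p10:
  fixes G :: "('a, 'b) monoid_scheme" and H K :: "'a set"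
  assumes "group G" and "finite (carrier G)"
    and "subgroup H G" and "subgroup K G" and "H \<subseteq> K"
  defines "GK \<equiv> G\<lparr>carrier := K\<rparr>"
  defines "S \<equiv> autocommutator_set GK H"
    and "L \<equiv> autocentre GK H"
  defines "bound \<equiv> 1 / real (card S) * (1 + (real (card S) - 1) / real (subgroup_index G H L))"
  shows "autocommuting_prob GK H \<ge> bound \<and>
    (autocommuting_prob GK H = bound \<longleftrightarrow>
      (\<forall>x \<in> H - L. auto_orbit GK x = x <#\<^bsub>GK\<^esub> S))"
proof -
  \<comment> \<open>K is a group in its own right, so the proposition applies with K as the ambient
    group.\<close>
  interpret GK: group GK
    unfolding GK_def using assms(1,4) by (rule group.subgroup_imp_group)
  have "finite (carrier GK)"
    using assms(2) subgroup.subset [OF assms(4)] finite_subset by (auto simp: GK_def)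
  moreover have "subgroup H GK"
    unfolding GK_def using assms(1,3-5) by (rule group.subgroup_incl)
  \<comment> \<open>The index restricts the carrier to H, which overrides the earlier restriction to
    K.\<close>
  moreover have "subgroup_index G H L = subgroup_index GK H L"
    by (simp add: subgroup_index_def GK_def)
  ultimately show ?thesis
    using GK.autocommuting_prob_bound [of H] by (simp add: bound_def S_def L_def)
qed

end
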